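(* Let $X$ be a non-empty heap. There is a one-to-one correspondence between: (a) the set $A$ of all idempotent heap endomorphisms of $X$, that is, of all heap endomorphisms $f$ of $X$ with $f^2=f$; (b) the set $B$ of all pairs $(\omega,Y)$, where $\omega$ is a congruence on $X$, $Y$ is a subheap of $X$, and $X=\omega\rtimes Y$. Given $f\in A$, the corresponding pair in $B$ is $(\ker(f),f(X))$. Conversely, if $(\omega,Y)\in B$, the corresponding idempotent endomorphism $f$ of $X$ is defined by $Y\cap[x]_\omega=\{f(x)\}$ for every $x\in X$.
   Context: A heap is a set $X$ with a ternary operation $[x,y,z]$ such that $[[x,y,z],w,u]=[x,y,[z,w,u]]$, $[x,x,y]=y$ and $[x,y,y]=x$ for all $x,y,z,w,u\in X$. Heap morphisms are the maps preserving the ternary operation; a subheap is a subset closed under it; a congruence is an equivalence relation compatible with it. $[x]_\omega$ denotes the equivalence class of $x$ modulo $\omega$. The kernel $\ker(f)$ of a heap morphism $f$ is the congruence $\{(x,x')\mid f(x)=f(x')\}$. For a congruence $\omega$ and a subheap $Y$ of $X$, one says that $X$ is the (inner) semidirect product of $\omega$ and $Y$, written $X=\omega\rtimes Y$, if $Y\cap[x]_\omega$ is a singleton for every $x\in X$. *)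

theory Defs
  imports "HOL-Library.FuncSet"
begin

locale heap =
  fixes X :: "'a set" and t :: "'a \<Rightarrow> 'a \<Rightarrow> 'a \<Rightarrow> 'a"
  assumes closed: "\<lbrakk>x \<in> X; y \<in> X; z \<in> X\<rbrakk> \<Longrightarrow> t x y z \<in> X"
    and para_assoc:
      "\<lbrakk>x \<in> X; y \<in> X; z \<in> X; w \<in> X; u \<in> X\<rbrakk> \<Longrightarrow> t (t x y z) w u = t x y (t z w u)"
    and maltsev_left: "\<lbrakk>x \<in> X; y \<in> X\<rbrakk> \<Longrightarrow> t x x y = y"
    and maltsev_right: "\<lbrakk>x \<in> X; y \<in> X\<rbrakk> \<Longrightarrow> t x y y = x"

text \<open>Maps with domain \<open>X\<close> are represented by functions in \<open>extensional X\<close>, so that two of them are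
  equal in HOL iff they agree on \<open>X\<close>. For the same reason the composite of maps on \<open>X\<close> is
  \<open>compose X\<close> rather than \<open>(\<circ>)\<close>.\<close>

definition heap_hom ::
    "'a set \<Rightarrow> ('a \<Rightarrow> 'a \<Rightarrow> 'a \<Rightarrow> 'a) \<Rightarrow> 'b set \<Rightarrow> ('b \<Rightarrow> 'b \<Rightarrow> 'b \<Rightarrow> 'b) \<Rightarrow> ('a \<Rightarrow> 'b) set" where
  "heap_hom X t Y s =
     {f \<in> X \<rightarrow>\<^sub>E Y. \<forall>x\<in>X. \<forall>y\<in>X. \<forall>z\<in>X. f (t x y z) = s (f x) (f y) (f z)}"

definition idempotent_endos ::
    "'a set \<Rightarrow> ('a \<Rightarrow> 'a \<Rightarrow> 'a \<Rightarrow> 'a) \<Rightarrow> ('a \<Rightarrow> 'a) set" where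
  "idempotent_endos X t = {f \<in> heap_hom X t X t. compose X f f = f}"

text \<open>The empty set is a subheap.\<close>

definition subheap :: "'a set \<Rightarrow> ('a \<Rightarrow> 'a \<Rightarrow> 'a \<Rightarrow> 'a) \<Rightarrow> 'a set \<Rightarrow> bool" where
  "subheap X t Y \<longleftrightarrow> Y \<subseteq> X \<and> (\<forall>x\<in>Y. \<forall>y\<in>Y. \<forall>z\<in>Y. t x y z \<in> Y)"

definition heap_congruence ::
    "'a set \<Rightarrow> ('a \<Rightarrow> 'a \<Rightarrow> 'a \<Rightarrow> 'a) \<Rightarrow> ('a \<times> 'a) set \<Rightarrow> bool" where
  "heap_congruence X t \<omega> \<longleftrightarrow> equiv X \<omega> \<and>
     (\<forall>(x, x')\<in>\<omega>. \<forall>(y, y')\<in>\<omega>. \<forall>(z, z')\<in>\<omega>. (t x y z, t x' y' z') \<in> \<omega>)"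

definition heap_kernel :: "'a set \<Rightarrow> ('a \<Rightarrow> 'b) \<Rightarrow> ('a \<times> 'a) set" where
  "heap_kernel X f = {(x, x'). x \<in> X \<and> x' \<in> X \<and> f x = f x'}"

text \<open>\<open>semidirect X \<omega> Y\<close> is the condition written \<open>X = \<omega> \<rtimes> Y\<close>; the class of \<open>x\<close> modulo \<open>\<omega>\<close> is
  \<open>\<omega> `` {x}\<close>.\<close>

definition semidirect :: "'a set \<Rightarrow> ('a \<times> 'a) set \<Rightarrow> 'a set \<Rightarrow> bool" where
  "semidirect X \<omega> Y \<longleftrightarrow> (\<forall>x\<in>X. is_singleton (Y \<inter> \<omega> `` {x}))"

definition semidirect_pairs ::
    "'a set \<Rightarrow> ('a \<Rightarrow> 'a \<Rightarrow> 'a \<Rightarrow> 'a) \<Rightarrow> (('a \<times> 'a) set \<times> 'a set) set" where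
  "semidirect_pairs X t =
     {(\<omega>, Y). heap_congruence X t \<omega> \<and> subheap X t Y \<and> semidirect X \<omega> Y}"

definition endo_to_pair :: "'a set \<Rightarrow> ('a \<Rightarrow> 'a) \<Rightarrow> ('a \<times> 'a) set \<times> 'a set" where
  "endo_to_pair X f = (heap_kernel X f, f ` X)"

definition pair_to_endo :: "'a set \<Rightarrow> ('a \<times> 'a) set \<times> 'a set \<Rightarrow> 'a \<Rightarrow> 'a" where
  "pair_to_endo X = (\<lambda>(\<omega>, Y). \<lambda>x\<in>X. THE y. Y \<inter> \<omega> `` {x} = {y})"

end

theory Submission
  imports Defs
begin

text \<open>An idempotent endomorphism \<open>f\<close> chooses a representative of each class of
  its kernel: since \<open>f (f x) = f x\<close>, the value \<open>f x\<close> lies in the class of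
  \<open>x\<close>, and an element \<open>f a\<close> of the image in that class satisfies
  \<open>f a = f (f a) = f x\<close>. So the image meets the class exactly in \<open>f x\<close>
  (\<open>image_inter_kernel_class\<close>). This gives the semidirect condition and also recovers
  \<open>f\<close> from its kernel and image. Conversely, a pair \<open>(\<omega>, Y)\<close> in
  \<open>semidirect_pairs X t\<close> sends \<open>x\<close> to the one element of \<open>Y\<close>
  congruent to \<open>x\<close>. To compute this map at a point it suffices to exhibit an element of
  \<open>Y\<close> congruent to that point (\<open>pair_to_endo_eqI\<close>). Compatibility with
  \<open>t\<close>, idempotence, and the recovery of \<omega> and \<open>Y\<close> as kernel and
  image all come from such witnesses.\<close>

lemma idempotent_endosD:
  assumes "f \<in> idempotent_endos X t"
  shows "f \<in> extensional X"
    and "x \<in> X \<Longrightarrow> f x \<in> X"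
    and "\<lbrakk>x \<in> X; y \<in> X; z \<in> X\<rbrakk> \<Longrightarrow> f (t x y z) = t (f x) (f y) (f z)"
    and "x \<in> X \<Longrightarrow> f (f x) = f x"
proof -
  have "f \<in> X \<rightarrow>\<^sub>E X" and comp: "compose X f f = f"
    and hom: "\<forall>x\<in>X. \<forall>y\<in>X. \<forall>z\<in>X. f (t x y z) = t (f x) (f y) (f z)"
    using assms by (auto simp: idempotent_endos_def heap_hom_def)
  then show "f \<in> extensional X" and "x \<in> X \<Longrightarrow> f x \<in> X"
    by (auto simp: PiE_def)
  show "\<lbrakk>x \<in> X; y \<in> X; z \<in> X\<rbrakk> \<Longrightarrow> f (t x y z) = t (f x) (f y) (f z)"
    using hom by blast
  show "x \<in> X \<Longrightarrow> f (f x) = f x"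
    using compose_eq[of x X f f] comp by simp
qed

text \<open>Idempotence gives both halves: it puts \<open>f x\<close> in the fibre of
  \<open>f\<close> through \<open>x\<close>, and it makes every point of the image a fixed point, so
  that no other point of the image lies in that fibre.\<close>

lemma image_inter_kernel_class:
  assumes "f \<in> idempotent_endos X t" and "x \<in> X"
  shows "f ` X \<inter> heap_kernel X f `` {x} = {f x}"
  using assms(2) idempotent_endosD(2,4)[OF assms(1)]
  by (force simp: heap_kernel_def)

lemma heap_congruence_kernel:
  assumes "heap X t" and f: "f \<in> idempotent_endos X t"
  shows "heap_congruence X t (heap_kernel X f)"
proof -
  have "equiv X (heap_kernel X f)"
    by (auto simp: heap_kernel_def intro!: equivI refl_onI symI transI)
  then show ?thesis
    using heap.closed[OF assms(1)] idempotent_endosD(3)[OF f]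
    by (auto simp: heap_congruence_def heap_kernel_def)
qed

lemma subheap_image:
  assumes "heap X t" and f: "f \<in> idempotent_endos X t"
  shows "subheap X t (f ` X)"
  unfolding subheap_def
proof (intro conjI ballI)
  show "f ` X \<subseteq> X"
    using idempotent_endosD(2)[OF f] by blast
  fix x y z assume "x \<in> f ` X" "y \<in> f ` X" "z \<in> f ` X"
  then obtain a b c where "a \<in> X" "b \<in> X" "c \<in> X" "x = f a" "y = f b" "z = f c"
    by blast
  then show "t x y z \<in> f ` X"
    using idempotent_endosD(3)[OF f, of a b c] heap.closed[OF assms(1), of a b c]
    by (metis imageI)
qed

lemma endo_to_pair_in:
  assumes "heap X t" and "f \<in> idempotent_endos X t"
  shows "endo_to_pair X f \<in> semidirect_pairs X t"
  using heap_congruence_kernel[OF assms] subheap_image[OF assms]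
    image_inter_kernel_class[OF assms(2)]
  by (simp add: endo_to_pair_def semidirect_pairs_def semidirect_def)

lemma pair_to_endo_endo_to_pair:
  assumes f: "f \<in> idempotent_endos X t"
  shows "pair_to_endo X (endo_to_pair X f) = f"
\<comment> \<open>Agreement on \<open>X\<close> is enough, as both maps are extensional.\<close>
proof (rule extensionalityI[of _ X])
  fix x assume "x \<in> X"
  then show "pair_to_endo X (endo_to_pair X f) x = f x"
    by (simp add: pair_to_endo_def endo_to_pair_def image_inter_kernel_class[OF f])
qed (simp_all add: pair_to_endo_def endo_to_pair_def idempotent_endosD(1)[OF f])

text \<open>The semidirect condition makes the definite description in \<open>pair_to_endo\<close>
  well defined. The next two lemmas split this into existence and uniqueness of the
  representative.\<close>

lemma inter_class_eq_pair_to_endo: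
  assumes "semidirect X \<omega> Y" and "x \<in> X"
  shows "Y \<inter> \<omega> `` {x} = {pair_to_endo X (\<omega>, Y) x}"
proof -
  obtain y where "Y \<inter> \<omega> `` {x} = {y}"
    using assms by (auto simp: semidirect_def is_singleton_def)
  then show ?thesis
    using assms(2) by (simp add: pair_to_endo_def)
qed

lemma pair_to_endo_mem:
  assumes "semidirect X \<omega> Y" and "x \<in> X"
  shows "pair_to_endo X (\<omega>, Y) x \<in> Y" and "(x, pair_to_endo X (\<omega>, Y) x) \<in> \<omega>"
  using inter_class_eq_pair_to_endo[OF assms] by blast+

text \<open>The uniqueness half, used as a rule for evaluating \<open>pair_to_endo\<close>.\<close>

lemma pair_to_endo_eqI:
  assumes "semidirect X \<omega> Y" and "x \<in> X" and "y \<in> Y" and "(x, y) \<in> \<omega>"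
  shows "pair_to_endo X (\<omega>, Y) x = y"
proof -
  have "y \<in> Y \<inter> \<omega> `` {x}"
    using assms(3,4) by blast
  then show ?thesis
    by (simp only: inter_class_eq_pair_to_endo[OF assms(1,2)] singleton_iff)
qed

lemma pair_to_endo_in:
  assumes "heap X t" and "p \<in> semidirect_pairs X t"
  shows "pair_to_endo X p \<in> idempotent_endos X t"
proof -
  obtain \<omega> Y where p: "p = (\<omega>, Y)"
    and cong: "heap_congruence X t \<omega>" and sub: "subheap X t Y" and semi: "semidirect X \<omega> Y"
    using assms(2) by (auto simp: semidirect_pairs_def)
  let ?f = "pair_to_endo X (\<omega>, Y)"
  note mem = pair_to_endo_mem[OF semi]
  have YX: "Y \<subseteq> X" and refl: "\<And>x. x \<in> X \<Longrightarrow> (x, x) \<in> \<omega>"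
    using sub cong by (auto simp: subheap_def heap_congruence_def equiv_def dest: refl_onD)
  have ext: "?f \<in> extensional X"
    by (simp add: pair_to_endo_def)
  \<comment> \<open>The witness is the product of the representatives: it stays in \<open>Y\<close>
    because \<open>Y\<close> is a subheap, and is congruent to \<open>t x y z\<close> because
    \<omega> is a congruence.\<close>
  have "?f (t x y z) = t (?f x) (?f y) (?f z)" if "x \<in> X" "y \<in> X" "z \<in> X" for x y z
  proof (rule pair_to_endo_eqI[OF semi])
    show "t x y z \<in> X"
      using heap.closed[OF assms(1)] that by blast
    show "t (?f x) (?f y) (?f z) \<in> Y"
      using sub mem(1) that by (simp add: subheap_def)
    show "(t x y z, t (?f x) (?f y) (?f z)) \<in> \<omega>"
      using cong mem(2)[OF that(1)] mem(2)[OF that(2)] mem(2)[OF that(3)]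
      unfolding heap_congruence_def by blast
  qed
  \<comment> \<open>The point \<open>?f x\<close> lies in \<open>Y\<close> and is congruent to
    itself, so it is its own representative.\<close>
  moreover have "?f (?f x) = ?f x" if "x \<in> X" for x
    using pair_to_endo_eqI[OF semi] mem(1)[OF that] YX refl by blast
  then have "compose X ?f ?f = ?f"
    using ext by (intro extensionalityI[of _ X]) (simp_all add: compose_eq)
  ultimately show ?thesis
    using ext mem(1) YX by (auto simp: p idempotent_endos_def heap_hom_def PiE_def)
qed

lemma endo_to_pair_pair_to_endo:
  assumes "p \<in> semidirect_pairs X t"
  shows "endo_to_pair X (pair_to_endo X p) = p"
proof -
  obtain \<omega> Y where p: "p = (\<omega>, Y)"
    and eq: "equiv X \<omega>" and sub: "Y \<subseteq> X" and semi: "semidirect X \<omega> Y"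
    using assms by (auto simp: semidirect_pairs_def heap_congruence_def subheap_def)
  let ?f = "pair_to_endo X (\<omega>, Y)"
  note mem = pair_to_endo_mem[OF semi]
  have sym: "\<And>x y. (x, y) \<in> \<omega> \<Longrightarrow> (y, x) \<in> \<omega>"
    and trans: "\<And>x y z. (x, y) \<in> \<omega> \<Longrightarrow> (y, z) \<in> \<omega> \<Longrightarrow> (x, z) \<in> \<omega>"
    and refl: "\<And>x. x \<in> X \<Longrightarrow> (x, x) \<in> \<omega>"
    using eq by (auto simp: equiv_def dest: symD transD refl_onD)
  have "heap_kernel X ?f = \<omega>"
  proof (intro set_eqI iffI)
    fix q assume "q \<in> heap_kernel X ?f"
    then obtain x y where "q = (x, y)" "x \<in> X" "y \<in> X" "?f x = ?f y"
      by (auto simp: heap_kernel_def)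
    \<comment> \<open>Both \<open>x\<close> and \<open>y\<close> are congruent to their common
      representative, hence to each other.\<close>
    then show "q \<in> \<omega>"
      using mem(2) sym trans by metis
  next
    fix q assume q: "q \<in> \<omega>"
    then obtain x y where xy: "q = (x, y)" "x \<in> X" "y \<in> X"
      using equiv_type[OF eq] by blast
    \<comment> \<open>By transitivity the representative of \<open>y\<close> also serves for
      \<open>x\<close>.\<close>
    moreover have "?f x = ?f y"
      using pair_to_endo_eqI[OF semi xy(2)] mem[OF xy(3)] trans q xy(1) by blast
    ultimately show "q \<in> heap_kernel X ?f"
      by (simp add: heap_kernel_def)
  qed
  moreover have "?f ` X = Y"
  proof
    show "?f ` X \<subseteq> Y"
      using mem(1) by blast
    \<comment> \<open>Points of \<open>Y\<close> represent themselves, so \<open>Y\<close> consists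
      of values of \<open>?f\<close>.\<close>
    have "?f y = y" if "y \<in> Y" for y
      using pair_to_endo_eqI[OF semi] refl sub that by blast
    then show "Y \<subseteq> ?f ` X"
      using sub by force
  qed
  ultimately show ?thesis
    by (simp add: p endo_to_pair_def)
qed

theorem theorem5p2:
  fixes X :: "'a set" and t :: "'a \<Rightarrow> 'a \<Rightarrow> 'a \<Rightarrow> 'a"
  assumes "heap X t" and "X \<noteq> {}"
  shows "bij_betw (endo_to_pair X) (idempotent_endos X t) (semidirect_pairs X t) \<and>
         bij_betw (pair_to_endo X) (semidirect_pairs X t) (idempotent_endos X t) \<and>
         (\<forall>f\<in>idempotent_endos X t. pair_to_endo X (endo_to_pair X f) = f) \<and>
         (\<forall>p\<in>semidirect_pairs X t. endo_to_pair X (pair_to_endo X p) = p) \<and>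
         (\<forall>(\<omega>, Y)\<in>semidirect_pairs X t. \<forall>x\<in>X. Y \<inter> \<omega> `` {x} = {pair_to_endo X (\<omega>, Y) x})"
proof (intro conjI)
  have to_pair: "endo_to_pair X ` idempotent_endos X t \<subseteq> semidirect_pairs X t"
    and to_endo: "pair_to_endo X ` semidirect_pairs X t \<subseteq> idempotent_endos X t"
    using endo_to_pair_in[OF assms(1)] pair_to_endo_in[OF assms(1)] by blast+
  show inv1: "\<forall>f\<in>idempotent_endos X t. pair_to_endo X (endo_to_pair X f) = f"
    by (simp add: pair_to_endo_endo_to_pair)
  show inv2: "\<forall>p\<in>semidirect_pairs X t. endo_to_pair X (pair_to_endo X p) = p"
    by (simp add: endo_to_pair_pair_to_endo)
  show "bij_betw (endo_to_pair X) (idempotent_endos X t) (semidirect_pairs X t)"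
    by (rule bij_betw_byWitness[OF inv1 inv2 to_pair to_endo])
  show "bij_betw (pair_to_endo X) (semidirect_pairs X t) (idempotent_endos X t)"
    by (rule bij_betw_byWitness[OF inv2 inv1 to_endo to_pair])
  show "\<forall>(\<omega>, Y)\<in>semidirect_pairs X t. \<forall>x\<in>X. Y \<inter> \<omega> `` {x} = {pair_to_endo X (\<omega>, Y) x}"
    using inter_class_eq_pair_to_endo by (fastforce simp: semidirect_pairs_def)
qed

end
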